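(* Let $\Omega$ be a separable metric space with Borel $\sigma$-algebra $\mathcal{F}$, let $\mathcal{P}=\{P_\theta;\ \theta\in\Theta\}$ ($\Theta$ nonempty) be a family of probability measures on $(\Omega,\mathcal{F})$, and let $\nu_1,\nu_2$ be $\sigma$-finite measures on $(\Omega,\mathcal{F})$ with $\mathcal{P}\ll\nu_1$ and $\mathcal{P}\ll\nu_2$. Let $(A,\nu)$ be a dominating pair for $(\mathcal{P},\nu_1,\nu_2)$. Suppose that for every $\theta\in\Theta$ there exist continuous versions of the Radon-Nikodým derivatives $$f_{1,\theta}\in\left[\frac{dP_\theta|_A}{d\nu_1|_A}\right]_{\nu|_A},\qquad f_{2,\theta}\in\left[\frac{dP_\theta|_A}{d\nu_2|_A}\right]_{\nu|_A}$$ (continuous on $A$ with the subspace topology). Then for every $h\in\left[\frac{d\nu_2|_A}{d\nu_1|_A}\right]_{\nu|_A}$ there exists a measurable set $B_h\in\mathcal{F}(A)$ such that $P_\theta(B_h)=1$ for all $\theta\in\Theta$, $h$ is continuous on $B_h$ (i.e. the restriction of $h$ to the subspace $B_h$ is continuous), and $$f_{1,\theta}(\omega)=h(\omega)f_{2,\theta}(\omega)\qquad\text{for all }\theta\in\Theta\text{ and all }\omega\in B_h.$$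
   Context: $\mathcal{P}\ll\nu$ means $P_\theta\ll\nu$ for every $\theta\in\Theta$. For nonempty $A\in\mathcal{F}$, $\mathcal{F}(A)=\{B\in\mathcal{F}: B\subset A\}$, and $\mu|_A$ denotes the restriction of a measure $\mu$ to $(A,\mathcal{F}(A))$, i.e. $\mu|_A(B)=\mu(B)$ for $B\in\mathcal{F}(A)$. For a measurable real function $f$ and a measure $\mu$ on the same measurable space, $[f]_\mu$ is the set of all measurable real functions $g$ with $g=f$ $\mu$-a.e.; $\left[\frac{d\alpha}{d\beta}\right]_\mu$ is this class for $f$ a Radon-Nikodým derivative of $\alpha$ with respect to $\beta$. A minimal dominating measure for $\mathcal{P}$ is a $\sigma$-finite measure $\lambda$ with $\mathcal{P}\ll\lambda$ such that $\lambda\ll\mu$ for every $\sigma$-finite measure $\mu$ with $\mathcal{P}\ll\mu$. Dominating pair: $(A,\nu)$ is a dominating pair for $(\mathcal{P},\nu_1,\nu_2)$ if $A\in\mathcal{F}$; $\nu=\sum_{i=1}^\infty c_iP_{\theta_i}$ is a minimal dominating measure for $\mathcal{P}$, for some sequences $\{\theta_i\}\subset\Theta$ and $c_i\ge 0$ with $\sum_i c_i=1$; the measures $\nu_1|_A$, $\nu_2|_A$ and $\nu|_A$ are equivalent (mutually absolutely continuous); and $\nu(A)=1$. *)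

theory Defs
  imports "HOL-Probability.Probability"
begin

definition dominated :: "'i set \<Rightarrow> ('i \<Rightarrow> 'a measure) \<Rightarrow> 'a measure \<Rightarrow> bool" where
  "dominated \<Theta> P \<nu> \<longleftrightarrow> (\<forall>\<theta>\<in>\<Theta>. absolutely_continuous \<nu> (P \<theta>))"

definition minimal_dominating ::
    "'i set \<Rightarrow> ('i \<Rightarrow> 'a::topological_space measure) \<Rightarrow> 'a measure \<Rightarrow> bool" where
  "minimal_dominating \<Theta> P \<rho> \<longleftrightarrow>
     sets \<rho> = sets borel \<and> sigma_finite_measure \<rho> \<and> dominated \<Theta> P \<rho> \<and>
     (\<forall>\<mu>. sets \<mu> = sets borel \<longrightarrow> sigma_finite_measure \<mu> \<longrightarrow> dominated \<Theta> P \<mu>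
           \<longrightarrow> absolutely_continuous \<mu> \<rho>)"

definition equivalent_measures :: "'a measure \<Rightarrow> 'a measure \<Rightarrow> bool" where
  "equivalent_measures \<mu> \<nu> \<longleftrightarrow> absolutely_continuous \<mu> \<nu> \<and> absolutely_continuous \<nu> \<mu>"

(* For measurable A, the restriction of mu to (A, F(A)) is restrict_space mu A. *)
definition dominating_pair ::
    "'i set \<Rightarrow> ('i \<Rightarrow> 'a::topological_space measure) \<Rightarrow> 'a measure \<Rightarrow> 'a measure \<Rightarrow>
     'a set \<Rightarrow> 'a measure \<Rightarrow> bool" where
  "dominating_pair \<Theta> P \<nu>1 \<nu>2 A \<nu> \<longleftrightarrow>
     A \<in> sets borel \<and>
     (\<exists>(t :: nat \<Rightarrow> 'i) (c :: nat \<Rightarrow> real).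
        (\<forall>i. t i \<in> \<Theta>) \<and> (\<forall>i. 0 \<le> c i) \<and> c sums 1 \<and>
        (\<forall>E\<in>sets borel. emeasure \<nu> E = (\<Sum>i. ennreal (c i) * emeasure (P (t i)) E))) \<and>
     minimal_dominating \<Theta> P \<nu> \<and>
     equivalent_measures (restrict_space \<nu>1 A) (restrict_space \<nu>2 A) \<and>
     equivalent_measures (restrict_space \<nu>1 A) (restrict_space \<nu> A) \<and>
     equivalent_measures (restrict_space \<nu>2 A) (restrict_space \<nu> A) \<and>
     emeasure \<nu> A = 1"

definition ae_class :: "'a measure \<Rightarrow> ('a \<Rightarrow> real) \<Rightarrow> ('a \<Rightarrow> real) set" where
  "ae_class \<mu> f = {g \<in> borel_measurable \<mu>. AE x in \<mu>. g x = f x}"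

(* RN_class mu alpha beta is the class [d alpha / d beta]_mu; the library's RN_deriv takes
   the reference measure beta first and is ennreal-valued. When alpha and beta are sigma-finite
   and alpha << beta, it is finite beta-a.e., so enn2real changes it only on a beta-null set. *)
definition RN_class :: "'a measure \<Rightarrow> 'a measure \<Rightarrow> 'a measure \<Rightarrow> ('a \<Rightarrow> real) set" where
  "RN_class \<mu> \<alpha> \<beta> = ae_class \<mu> (\<lambda>x. enn2real (RN_deriv \<beta> \<alpha> x))"

end

(* Let \<nu> = sum of c_i P_(t_i). For \<nu>-almost every point of A, the chain rule gives
   f1_(t_i) = h f2_(t_i) for all i simultaneously, and some f2_(t_i) is positive. On the set C of
   these points h is locally a quotient of two of the continuous densities, hence continuous.
   For an arbitrary \<theta> the set where f1_\<theta> \<noteq> h f2_\<theta> is therefore relatively open in C, and it is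
   \<nu>-null, so it misses the support of \<nu> restricted to C. By separability this support has full
   measure in C; it is the required set, independent of \<theta>. *)
theory Submission
  imports Defs
begin

text \<open>Separability is a hypothesis on the space rather than a type class, so second
  countability is derived from it: the balls of radius \<open>1 / Suc n\<close> about the points of
  a countable dense set form a basis.\<close>

lemma separable_space_euclidean_countable_basis:
  assumes "separable_space (euclidean :: 'a topology)"
  obtains \<B> :: "'a::metric_space set set" where "countable \<B>" "topological_basis \<B>"
proof -
  obtain D :: "'a set" where D: "countable D" "closure D = UNIV"
    using assms by (auto simp: separable_space_def)
  define \<B> where "\<B> = (\<lambda>(d, n). ball d (1 / real (Suc n))) ` (D \<times> UNIV)"
  have "topological_basis \<B>"
  proof (rule topological_basisI)
    fix U :: "'a set" and x assume "open U" "x \<in> U"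
    then obtain e where e: "e > 0" "ball x e \<subseteq> U"
      by (meson openE)
    obtain n where n: "1 / real (Suc n) < e / 2"
      using e(1) by (metis half_gt_zero nat_approx_posE)
    obtain d where d: "d \<in> D" "dist d x < 1 / real (Suc n)"
      using D(2) closure_approachable[of x D] by (metis UNIV_I of_nat_0_less_iff zero_less_Suc zero_less_divide_1_iff)
    have "ball d (1 / real (Suc n)) \<subseteq> ball x e"
    proof
      fix y assume "y \<in> ball d (1 / real (Suc n))"
      then show "y \<in> ball x e"
        using d(2) n dist_triangle[of x y d] by (simp add: dist_commute)
    qed
    then show "\<exists>V\<in>\<B>. x \<in> V \<and> V \<subseteq> U"
      using d e(2) unfolding \<B>_def
      by (intro bexI[of _ "ball d (1 / real (Suc n))"]) (auto simp: mem_ball)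
  qed (auto simp: \<B>_def)
  moreover have "countable \<B>"
    using D(1) by (simp add: \<B>_def)
  ultimately show thesis using that by blast
qed

text \<open>\<open>B\<close> is the support of \<open>M\<close> relative to \<open>C\<close>: remove
  from \<open>C\<close> every basic open set that meets it in a null set. Only countably many sets
  are removed, so the loss is null. If an open \<open>U\<close> meets \<open>C\<close> in a null
  set, so does each basic set inside \<open>U\<close>, and all of these have been removed.\<close>

lemma relative_support_exists:
  fixes M :: "'a::metric_space measure"
  assumes sep: "separable_space (euclidean :: 'a topology)"
    and sets: "sets M = sets borel" and C: "C \<in> sets M"
  obtains B where "B \<in> sets M" "B \<subseteq> C" "C - B \<in> null_sets M"
    "\<And>U. open U \<Longrightarrow> C \<inter> U \<in> null_sets M \<Longrightarrow> B \<inter> U = {}"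
proof -
  obtain \<B> :: "'a set set" where \<B>: "countable \<B>" "topological_basis \<B>"
    using separable_space_euclidean_countable_basis[OF sep] .
  define \<V> where "\<V> = {V \<in> \<B>. C \<inter> V \<in> null_sets M}"
  define B where "B = C - \<Union>\<V>"
  have op: "open (\<Union>\<V>)"
    using topological_basis_open[OF \<B>(2)] by (auto simp: \<V>_def)
  have null: "(\<Union>V\<in>\<V>. C \<inter> V) \<in> null_sets M"
    using \<B>(1) by (intro null_sets_UN') (auto simp: \<V>_def)
  show thesis
  proof
    show "B \<in> sets M"
      using C op by (auto simp: B_def sets)
    show "C - B \<in> null_sets M"
      using null by (rule back_subst[of "\<lambda>X. X \<in> null_sets M"]) (auto simp: B_def)
    fix U assume U: "open U" "C \<inter> U \<in> null_sets M"
    show "B \<inter> U = {}"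
    proof (rule ccontr)
      assume "B \<inter> U \<noteq> {}"
      then obtain x where x: "x \<in> B" "x \<in> U" by auto
      obtain V where V: "V \<in> \<B>" "x \<in> V" "V \<subseteq> U"
        using topological_basisE[OF \<B>(2) U(1) x(2)] by blast
      have "C \<inter> V \<in> sets M"
        using C topological_basis_open[OF \<B>(2) V(1)] by (auto simp: sets)
      then have "C \<inter> V \<in> null_sets M"
        using V(3) by (intro null_sets_subset[OF U(2)]) auto
      then show False
        using V x by (auto simp: B_def \<V>_def)
    qed
  qed (simp add: B_def)
qed

lemma absolutely_continuous_restrict_space:
  assumes "absolutely_continuous M N" "sets N = sets M" "A \<in> sets M"
  shows "absolutely_continuous (restrict_space M A) (restrict_space N A)"
  using assms by (auto simp: absolutely_continuous_def null_sets_restrict_space)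

text \<open>The product is a density of \<open>L\<close> with respect to \<open>M\<close>, so
  uniqueness of the derivative applies. The identity is kept in \<open>ennreal\<close>.\<close>

lemma RN_deriv_chain:
  assumes M: "sigma_finite_measure M" and N: "sigma_finite_measure N" and L: "sigma_finite_measure L"
    and MN: "absolutely_continuous M N" "sets N = sets M"
    and NL: "absolutely_continuous N L" "sets L = sets N"
  shows "AE x in M. RN_deriv M L x = RN_deriv M N x * RN_deriv N L x"
proof -
  interpret M: sigma_finite_measure M by fact
  interpret N: sigma_finite_measure N by fact
  have meas: "RN_deriv N L \<in> borel_measurable M"
    using borel_measurable_RN_deriv[of N L] measurable_cong_sets[OF MN(2) refl] by blast
  have "density M (\<lambda>x. RN_deriv M N x * RN_deriv N L x) = density (density M (RN_deriv M N)) (RN_deriv N L)"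
    using meas by (simp add: density_density_eq)
  also have "\<dots> = L"
    using MN NL by (simp add: M.density_RN_deriv N.density_RN_deriv)
  finally have "AE x in M. RN_deriv M N x * RN_deriv N L x = RN_deriv M L x"
    using meas by (intro M.RN_deriv_unique) auto
  then show ?thesis by eventually_elim simp
qed

text \<open>A measure gives no mass to the zero set of its own density. This makes division by some
  \<open>f2 (t i)\<close> possible at almost every point of \<open>A\<close>.\<close>

lemma (in sigma_finite_measure) RN_deriv_real_pos:
  assumes "finite_measure N" "absolutely_continuous M N" "sets N = sets M"
  shows "AE x in N. 0 < enn2real (RN_deriv M N x)"
proof -
  obtain D where D: "AE x in M. RN_deriv M N x = ennreal (D x)" "AE x in N. 0 < D x"
    using real_RN_deriv[OF assms] by metis
  have "AE x in N. RN_deriv M N x = ennreal (D x)"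
    by (rule absolutely_continuous_AE[OF assms(3,2) D(1)])
  with D(2) show ?thesis by eventually_elim simp
qed

theorem theorem2:
  fixes \<Theta> :: "'i set"
    and P :: "'i \<Rightarrow> 'a::metric_space measure"
    and \<nu>1 \<nu>2 \<nu> :: "'a measure"
    and A :: "'a set"
    and f1 f2 :: "'i \<Rightarrow> 'a \<Rightarrow> real"
  assumes separable: "separable_space (euclidean :: 'a topology)"
    and \<Theta>: "\<Theta> \<noteq> {}"
    and P: "\<And>\<theta>. \<theta> \<in> \<Theta> \<Longrightarrow> prob_space (P \<theta>) \<and> sets (P \<theta>) = sets borel"
    and \<nu>1: "sets \<nu>1 = sets borel" "sigma_finite_measure \<nu>1" "dominated \<Theta> P \<nu>1"
    and \<nu>2: "sets \<nu>2 = sets borel" "sigma_finite_measure \<nu>2" "dominated \<Theta> P \<nu>2"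
    and pair: "dominating_pair \<Theta> P \<nu>1 \<nu>2 A \<nu>"
    and f1: "\<And>\<theta>. \<theta> \<in> \<Theta> \<Longrightarrow>
        f1 \<theta> \<in> RN_class (restrict_space \<nu> A) (restrict_space (P \<theta>) A) (restrict_space \<nu>1 A) \<and>
        continuous_on A (f1 \<theta>)"
    and f2: "\<And>\<theta>. \<theta> \<in> \<Theta> \<Longrightarrow>
        f2 \<theta> \<in> RN_class (restrict_space \<nu> A) (restrict_space (P \<theta>) A) (restrict_space \<nu>2 A) \<and>
        continuous_on A (f2 \<theta>)"
  shows "\<forall>h \<in> RN_class (restrict_space \<nu> A) (restrict_space \<nu>2 A) (restrict_space \<nu>1 A).
      \<exists>B \<in> sets borel. B \<subseteq> A \<and>
        (\<forall>\<theta>\<in>\<Theta>. measure (P \<theta>) B = 1) \<and>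
        continuous_on B h \<and>
        (\<forall>\<theta>\<in>\<Theta>. \<forall>\<omega>\<in>B. f1 \<theta> \<omega> = h \<omega> * f2 \<theta> \<omega>)"
proof
  fix h
  assume h: "h \<in> RN_class (restrict_space \<nu> A) (restrict_space \<nu>2 A) (restrict_space \<nu>1 A)"
  obtain t c where A: "A \<in> sets borel" and t: "\<And>i. t i \<in> \<Theta>" and c: "\<And>i. 0 \<le> c i" "c sums 1"
    and \<nu>_eq: "\<And>E. E \<in> sets borel \<Longrightarrow> emeasure \<nu> E = (\<Sum>i. ennreal (c i) * emeasure (P (t i)) E)"
    and min: "minimal_dominating \<Theta> P \<nu>"
    and eq12: "equivalent_measures (restrict_space \<nu>1 A) (restrict_space \<nu>2 A)"
    and eq1: "equivalent_measures (restrict_space \<nu>1 A) (restrict_space \<nu> A)"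
    and eq2: "equivalent_measures (restrict_space \<nu>2 A) (restrict_space \<nu> A)"
    and \<nu>A: "emeasure \<nu> A = 1"
    using pair unfolding dominating_pair_def by blast
  have sets_\<nu>: "sets \<nu> = sets borel" and dom: "dominated \<Theta> P \<nu>"
    using min by (auto simp: minimal_dominating_def)
  note sp = sets_eq_imp_space_eq[OF sets_\<nu>]
  have cl: "A \<inter> space \<nu> \<in> sets \<nu>" using A sets_\<nu> sp by simp
  let ?N = "restrict_space \<nu> A" and ?N1 = "restrict_space \<nu>1 A" and ?N2 = "restrict_space \<nu>2 A"
  let ?P = "\<lambda>\<theta>. restrict_space (P \<theta>) A"
  have spN: "space ?N = A" using A sets_\<nu> by simp
  have sets_N: "sets ?N1 = sets ?N" "sets ?N2 = sets ?N" "\<And>\<theta>. \<theta> \<in> \<Theta> \<Longrightarrow> sets (?P \<theta>) = sets ?N"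
    using \<nu>1(1) \<nu>2(1) P sets_\<nu> by (simp_all add: sets_restrict_space)
  interpret N1: sigma_finite_measure ?N1
    using A \<nu>1 by (intro sigma_finite_measure_restrict_space) auto
  interpret N2: sigma_finite_measure ?N2
    using A \<nu>2 by (intro sigma_finite_measure_restrict_space) auto
  have fin: "finite_measure (?P \<theta>)" if "\<theta> \<in> \<Theta>" for \<theta>
    using P[OF that] A by (intro finite_measure_restrict_space) (auto simp: prob_space_def)
  have ac: "absolutely_continuous ?N (?P \<theta>)" "absolutely_continuous ?N2 (?P \<theta>)" if "\<theta> \<in> \<Theta>" for \<theta>
    using dom \<nu>2 P[OF that] sets_\<nu> A that
    by (auto intro!: absolutely_continuous_restrict_space simp: dominated_def)
  \<comment> \<open>Derivatives are determined modulo null sets of their reference measure, the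
    given classes modulo null sets of \<open>?N\<close>; equivalence on \<open>A\<close> reconciles
    the two.\<close>
  have toN: "AE x in ?N. Q x" if "(AE x in ?N1. Q x) \<or> (AE x in ?N2. Q x)" for Q
    using that eq1 eq2 sets_N by (auto simp: equivalent_measures_def intro: absolutely_continuous_AE)
  have hm: "h \<in> borel_measurable ?N" and h_eq: "AE x in ?N. h x = enn2real (RN_deriv ?N1 ?N2 x)"
    using h by (auto simp: RN_class_def ae_class_def)
  have f1m: "f1 \<theta> \<in> borel_measurable ?N" and f1c: "continuous_on A (f1 \<theta>)"
    and f1_eq: "AE x in ?N. f1 \<theta> x = enn2real (RN_deriv ?N1 (?P \<theta>) x)" if "\<theta> \<in> \<Theta>" for \<theta>
    using f1[OF that] by (auto simp: RN_class_def ae_class_def)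
  have f2m: "f2 \<theta> \<in> borel_measurable ?N" and f2c: "continuous_on A (f2 \<theta>)"
    and f2_eq: "AE x in ?N. f2 \<theta> x = enn2real (RN_deriv ?N2 (?P \<theta>) x)" if "\<theta> \<in> \<Theta>" for \<theta>
    using f2[OF that] by (auto simp: RN_class_def ae_class_def)
  have chain: "AE x in ?N. f1 \<theta> x = h x * f2 \<theta> x" if \<theta>: "\<theta> \<in> \<Theta>" for \<theta>
  proof -
    have "AE x in ?N1. RN_deriv ?N1 (?P \<theta>) x = RN_deriv ?N1 ?N2 x * RN_deriv ?N2 (?P \<theta>) x"
      using fin[OF \<theta>] ac(2)[OF \<theta>] eq12 sets_N \<theta>
      by (intro RN_deriv_chain)
        (auto simp: equivalent_measures_def finite_measure_def
          intro: N1.sigma_finite_measure_axioms N2.sigma_finite_measure_axioms)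
    then have "AE x in ?N. RN_deriv ?N1 (?P \<theta>) x = RN_deriv ?N1 ?N2 x * RN_deriv ?N2 (?P \<theta>) x"
      by (intro toN) simp
    \<comment> \<open>\<open>enn2real\<close> is multiplicative on all of \<open>ennreal\<close>,
      sending infinity to 0, so the identity passes to real values pointwise.\<close>
    with h_eq f1_eq[OF \<theta>] f2_eq[OF \<theta>] show ?thesis
      by eventually_elim (simp add: enn2real_mult)
  qed
  define G where "G = {x \<in> space ?N. \<exists>i. 0 < f2 (t i) x}"
  have [measurable]: "h \<in> borel_measurable ?N" "f1 (t i) \<in> borel_measurable ?N"
      "f2 (t i) \<in> borel_measurable ?N" for i
    using hm f1m f2m t by auto
  have "G \<in> sets ?N" unfolding G_def by measurable
  then have G: "G \<in> sets borel" using cl by (simp add: sets_restrict_space_iff sets_\<nu>)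
  \<comment> \<open>On \<open>A - G\<close> every \<open>f2 (t i)\<close> is nonpositive, whereas
    \<open>f2 (t i)\<close> is positive \<open>P (t i)\<close>-a.e. on \<open>A\<close>. The series
    for \<nu> then makes \<open>A - G\<close> a \<nu>-null set.\<close>
  have "emeasure (P (t i)) (A - G) = 0" for i
  proof -
    have "AE x in ?P (t i). 0 < enn2real (RN_deriv ?N2 (?P (t i)) x)"
      using t sets_N by (intro N2.RN_deriv_real_pos fin ac) auto
    moreover have "AE x in ?P (t i). f2 (t i) x = enn2real (RN_deriv ?N2 (?P (t i)) x)"
      using t sets_N by (intro absolutely_continuous_AE[OF _ ac(1) f2_eq]) auto
    ultimately have "AE x in ?P (t i). 0 < f2 (t i) x"
      by eventually_elim simp
    then have "AE x in P (t i). x \<in> A \<longrightarrow> 0 < f2 (t i) x"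
      using A P[OF t] by (subst (asm) AE_restrict_space_iff) auto
    then have "AE x in P (t i). x \<notin> A - G"
      by eventually_elim (auto simp: G_def spN)
    moreover have "A - G \<in> sets (P (t i))"
      using A G P[OF t] by simp
    ultimately show ?thesis
      using AE_iff_null_sets null_setsD1 by blast
  qed
  then have "A - G \<in> null_sets \<nu>"
    using A G \<nu>_eq[of "A - G"] by (auto simp: null_sets_def sets_\<nu>)
  then have AE_G: "AE x in ?N. \<exists>i. 0 < f2 (t i) x"
    by (subst AE_restrict_space_iff[OF cl]) (auto dest!: AE_not_in simp: G_def spN elim: AE_mp)
  \<comment> \<open>Only the countably many indices \<open>t i\<close> enter: this keeps
    \<open>C\<close> measurable and of full measure even when \<open>\<Theta>\<close> is
    uncountable.\<close>
  define C where "C = {x \<in> space ?N. (\<forall>i. f1 (t i) x = h x * f2 (t i) x) \<and> (\<exists>i. 0 < f2 (t i) x)}"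
  have "C \<in> sets ?N" unfolding C_def by measurable
  then have C: "C \<in> sets \<nu>" and CA: "C \<subseteq> A" using cl by (simp_all add: sets_restrict_space_iff)
  have AE_C: "AE x in ?N. x \<in> C"
  proof -
    have "AE x in ?N. \<forall>i. f1 (t i) x = h x * f2 (t i) x"
      using chain t by (subst AE_all_countable) auto
    with AE_G AE_space show ?thesis by eventually_elim (auto simp: C_def)
  qed
  have hC: "continuous_on C h"
    unfolding continuous_on_eq_continuous_within
  proof
    fix x assume x: "x \<in> C"
    then obtain i where i: "0 < f2 (t i) x" by (auto simp: C_def)
    have c1: "continuous_on C (f1 (t i))" and c2: "continuous_on C (f2 (t i))"
      using f1c f2c t CA continuous_on_subset by blast+
    \<comment> \<open>This quotient equals \<open>h\<close> at every point of \<open>C\<close> where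
      \<open>f2 (t i)\<close> is positive, which is a relatively open neighbourhood of
      \<open>x\<close> in \<open>C\<close>; so its continuity at \<open>x\<close> carries over to
      \<open>h\<close>.\<close>
    have "continuous (at x within C) (\<lambda>y. f1 (t i) y / f2 (t i) y)"
      using c1 c2 x i by (intro continuous_at_within_divide) (auto simp: continuous_on_eq_continuous_within)
    then show "continuous (at x within C) h"
    proof (rule continuous_transform_within_openin)
      show "openin (top_of_set C) (C \<inter> f2 (t i) -` {0<..})"
        using c2 by (intro continuous_openin_preimage_gen) auto
    qed (use x i in \<open>auto simp: C_def\<close>)
  qed
  obtain B where B: "B \<in> sets \<nu>" "B \<subseteq> C" "C - B \<in> null_sets \<nu>"
    and supp: "\<And>U. open U \<Longrightarrow> C \<inter> U \<in> null_sets \<nu> \<Longrightarrow> B \<inter> U = {}"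
    using relative_support_exists[OF separable sets_\<nu> C] by blast
  \<comment> \<open>Together with \<open>emeasure \<nu> A = 1\<close> this makes the complement of
    \<open>A\<close> null, so that \<open>B\<close> has full measure in the whole space and not
    merely in \<open>A\<close>.\<close>
  have "emeasure \<nu> UNIV = 1"
  proof -
    have "emeasure (P (t i)) UNIV = 1" for i
      using P[OF t, of i] prob_space.emeasure_space_1[of "P (t i)"]
        sets_eq_imp_space_eq[of "P (t i)" borel] by simp
    then show ?thesis
      using \<nu>_eq[of UNIV] c by (simp add: suminf_ennreal_eq[OF c])
  qed
  then interpret \<nu>: prob_space \<nu> by (intro prob_spaceI) (simp add: sp)
  have "AE x in \<nu>. x \<in> A"
    using \<nu>A A sets_\<nu> by (intro \<nu>.AE_prob_1) (simp add: measure_def)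
  moreover have "AE x in \<nu>. x \<in> A \<longrightarrow> x \<in> C"
    using AE_C by (simp add: AE_restrict_space_iff[OF cl])
  ultimately have AE_B: "AE x in \<nu>. x \<in> B"
    using AE_not_in[OF B(3)] by eventually_elim blast
  have "measure (P \<theta>) B = 1" if \<theta>: "\<theta> \<in> \<Theta>" for \<theta>
  proof -
    interpret prob_space "P \<theta>" using P[OF \<theta>] by simp
    \<comment> \<open>Domination by \<nu> carries full measure of \<open>B\<close> over to every
      \<open>P \<theta>\<close>, including \<theta> outside the sequence \<open>t\<close>.\<close>
    have "AE x in P \<theta>. x \<in> B"
      using dom \<theta> P[OF \<theta>] by (intro absolutely_continuous_AE[OF _ _ AE_B]) (auto simp: dominated_def sets_\<nu>)
    then show ?thesis
      using B(1) P[OF \<theta>] by (subst prob_eq_1) (auto simp: sets_\<nu>)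
  qed
  moreover have "f1 \<theta> \<omega> = h \<omega> * f2 \<theta> \<omega>" if \<theta>: "\<theta> \<in> \<Theta>" and \<omega>: "\<omega> \<in> B" for \<theta> \<omega>
  proof (rule ccontr)
    assume neq: "f1 \<theta> \<omega> \<noteq> h \<omega> * f2 \<theta> \<omega>"
    \<comment> \<open>The exceptional null set of \<open>chain\<close> depends on \<theta>, so it
      cannot be removed for all \<theta> at once. Continuity of \<open>g\<close> on \<open>C\<close>
      shows instead that its trace on \<open>C\<close> is cut out by an open \<open>U\<close>, and
      \<open>supp\<close> keeps \<open>B\<close> away from every such \<open>U\<close>.\<close>
    define g where "g y = f1 \<theta> y - h y * f2 \<theta> y" for y
    have "continuous_on C g"
      unfolding g_def using f1c[OF \<theta>] f2c[OF \<theta>] CA hC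
      by (intro continuous_intros) (auto intro: continuous_on_subset)
    then have "openin (top_of_set C) (C \<inter> g -` (- {0}))"
      by (intro continuous_openin_preimage_gen) auto
    then obtain U where U: "open U" "C \<inter> g -` (- {0}) = C \<inter> U"
      by (auto simp: openin_open)
    have "AE x in \<nu>. x \<in> A \<longrightarrow> g x = 0"
      using chain[OF \<theta>] by (simp add: AE_restrict_space_iff[OF cl] g_def)
    then have "AE x in \<nu>. x \<notin> C \<inter> U"
      by eventually_elim (use U(2) CA in blast)
    moreover have "C \<inter> U \<in> sets \<nu>"
      using C U(1) by (auto simp: sets_\<nu>)
    ultimately have "B \<inter> U = {}"
      by (intro supp U(1)) (simp add: AE_iff_null_sets)
    then show False
      using \<omega> B(2) U(2) neq by (auto simp: g_def)
  qed
  ultimately show "\<exists>B \<in> sets borel. B \<subseteq> A \<and> (\<forall>\<theta>\<in>\<Theta>. measure (P \<theta>) B = 1) \<and>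
      continuous_on B h \<and> (\<forall>\<theta>\<in>\<Theta>. \<forall>\<omega>\<in>B. f1 \<theta> \<omega> = h \<omega> * f2 \<theta> \<omega>)"
    using B CA hC by (intro bexI[of _ B]) (auto simp: sets_\<nu> intro: continuous_on_subset)
qed

end
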